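(* For any kernel $K$ (a monotone decreasing function of $\|\mathbf{p}-\mathbf{q}\|$), the expected query time of the importance-sampling query procedure described in the context is $\widetilde{O}\left(\epsilon^{-2}\, n^{o(1)}\cdot \mathrm{cost}(K)\right)$.
   Context: Let $P=\{\mathbf{p}_1,\dots,\mathbf{p}_n\}\subset\mathbb{R}^d$, let $\mathbf{q}\in\mathbb{R}^d$ be a query, and let $K(\mathbf{p},\mathbf{q})=f(\|\mathbf{p}-\mathbf{q}\|)$ for a monotone decreasing function $f$. Let $\mu^*:=\frac1n\sum_{i}K(\mathbf{p}_i,\mathbf{q})$, let $\mu\ge\mu^*$ be a given parameter, $w_i:=K(\mathbf{p}_i,\mathbf{q})$, $J:=\lceil\log_2(1/\mu)\rceil$, and let $\epsilon$ be a precision parameter. For $j\in[J]$ define the weight levels $L_j:=\{\mathbf{p}_i\in P: w_i\in(2^{-j},2^{-j+1}]\}$, $L_{J+1}:=P\setminus\bigcup_{j\in[J]}L_j$, and the distance levels $r_j:=\max\{r: f(r)\in(2^{-j},2^{-j+1}]\}$. For $j\in[J]$ and $i\in\{j+1,\dots,J+1\}$ let $c_{i,j}:=\min\{r_{i-1}/r_j,\log^{1/7}n\}$. Define $\mathrm{cost}(K,j):=2^{\max_{i=j+1,\dots,J+1}\lceil (i-j)/(c_{i,j}^2(1-o(1)))\rceil}$ and $\mathrm{cost}(K):=\max_{j\in[J]}\mathrm{cost}(K,j)$. For each $j$, let $\mathcal{H}_j$ be the Andoni–Indyk Euclidean LSH family for near radius $r_j$ (with parameter $t=\log^{2/3}n$,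 so each evaluation takes $n^{o(1)}$ time), with near collision probability $p_{\mathrm{near},j}$ (collision probability of points at distance $\le r_j$) and with collision probability at most $p_{\mathrm{near},j}^{c^2(1-o(1))}$ for points at distance $\ge c\,r_j$, $1\le c\le\log^{1/7}n$. Let $k_j:=\frac{-1}{\log p_{\mathrm{near},j}}\max_{i=j+1,\dots,J+1}\lceil (i-j)/(c_{i,j}^2(1-o(1)))\rceil$. Preprocessing: for $K_1=\frac{C\log n}{\epsilon^2}\mu^{-o(1)}$ independent repetitions $a$ ($C$ a universal constant), for each $j\in[J]$, sample each point of $P$ independently with probability $\min\{\frac{1}{2^jn\mu},1\}$, draw $K_2=100\log n\cdot p_{\mathrm{near},j}^{-k_j}$ independent hash functions from $\mathcal{H}_j^{k_j}$ (concatenation of $k_j$ functions) and hash the sample with each, storing nonempty buckets; also store a sample of $P$ where each point is kept with probability $1/n$. Query: for each repetition $a$ and each $j$, scan the bucket of $\mathbf{q}$ under each of the $K_2$ hash functions and recover the points of $L_j$; scan the $1/n$-sample to recover points of $L_{J+1}$; for the set $S$ of recovered points output $Z_a=\sum_{\mathbf{p}_i\in S}w_i/p_i$, where $p_i=\min\{\frac{1}{2^jn\mu},1\}$ if $\mathbf{p}_i\in L_j$, $j\in[J]$, and $p_i=1/n$ if $\mathbf{p}_i\in L_{J+1}$.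
   Formalization: Assumes n^{-A} ≤ μ < 1 for a fixed A (else μ^{-o(1)} need not be n^{o(1)}), f ≥ 0, ε ≤ 1, r_j a supremum that exists and is positive, point-processing time n^{o(1)}, and the LSH facts e^{-O(√t)} ≤ p_near ≤ e^{-b}. *)

theory Defs
  imports "HOL-Probability.Probability"
begin

text \<open>
  The dimension \<open>d\<close> must be quantified after the constants hidden in the asymptotic bound,
  so the points are elements of the carrier \<^term>\<open>topspace (Euclidean_space d)\<close>.
\<close>

definition edist :: "nat \<Rightarrow> (nat \<Rightarrow> real) \<Rightarrow> (nat \<Rightarrow> real) \<Rightarrow> real" where
  "edist d x y = L2_set (\<lambda>i. x i - y i) {..<d}"

definition num_levels :: "real \<Rightarrow> nat" where
  "num_levels \<mu> = nat \<lceil>log 2 (1 / \<mu>)\<rceil>"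

definition band :: "nat \<Rightarrow> real set" where
  "band j = {2 powr (- real j) <.. 2 powr (1 - real j)}"

text \<open>
  The distance level \<open>r\<^sub>j\<close> is a supremum: since \<^term>\<open>band j\<close> is open at its lower end, the
  maximum is not attained already for continuous \<open>f\<close>.
\<close>

definition radius_set :: "(real \<Rightarrow> real) \<Rightarrow> nat \<Rightarrow> real set" where
  "radius_set f j = {r. 0 \<le> r \<and> f r \<in> band j}"

definition radius :: "(real \<Rightarrow> real) \<Rightarrow> nat \<Rightarrow> real" where
  "radius f j = Sup (radius_set f j)"

definition ratio :: "nat \<Rightarrow> (real \<Rightarrow> real) \<Rightarrow> nat \<Rightarrow> nat \<Rightarrow> real" where
  "ratio n f i j = min (radius f (i - 1) / radius f j) (log 2 (real n) powr (1 / 7))"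

text \<open>In the following, \<open>\<alpha>\<close> is the value at \<open>n\<close> of the \<open>o(1)\<close> term in \<open>c\<^sup>2(1 - o(1))\<close>.\<close>

definition cost_exponent :: "nat \<Rightarrow> real \<Rightarrow> (real \<Rightarrow> real) \<Rightarrow> real \<Rightarrow> nat \<Rightarrow> int" where
  "cost_exponent n \<alpha> f \<mu> j =
     Max ((\<lambda>i. \<lceil>(real i - real j) / ((ratio n f i j)\<^sup>2 * (1 - \<alpha>))\<rceil>) ` {j + 1..num_levels \<mu> + 1})"

definition level_cost :: "nat \<Rightarrow> real \<Rightarrow> (real \<Rightarrow> real) \<Rightarrow> real \<Rightarrow> nat \<Rightarrow> real" where
  "level_cost n \<alpha> f \<mu> j = 2 powr real_of_int (cost_exponent n \<alpha> f \<mu> j)"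

definition kernel_cost :: "nat \<Rightarrow> real \<Rightarrow> (real \<Rightarrow> real) \<Rightarrow> real \<Rightarrow> real" where
  "kernel_cost n \<alpha> f \<mu> = Max (level_cost n \<alpha> f \<mu> ` {1..num_levels \<mu>})"

text \<open>
  The guarantees of the Andoni--Indyk family on \<open>\<real>\<^sup>d\<close> for near radius \<open>r\<close> and parameter
  \<open>t = log\<^bsup>2/3\<^esup> n\<close>; the family is a probability distribution \<open>H\<close> on hash functions.
  Its near collision probability is \<open>e\<^bsup>-\<Theta>(\<surd>t)\<^esup>\<close>: the lower bound \<open>e\<^bsup>-O(\<surd>t)\<^esup>\<close> and separation
  from \<open>1\<close> are recorded, as without them the number \<open>k\<^sub>j\<close> of concatenated functions and the
  loss in rounding it to an integer would be unbounded.
  The number \<open>\<tau>\<close> bounds the time of one evaluation, and \<open>\<eta>\<close> is an \<open>o(1)\<close> term.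
\<close>

locale andoni_indyk_lsh = prob_space H
  for H :: "((nat \<Rightarrow> real) \<Rightarrow> 'b) measure" +
  fixes n d :: nat and \<alpha> \<eta> B b r p_near \<tau> :: real
  assumes collision_event:
      "\<lbrakk>x \<in> topspace (Euclidean_space d); y \<in> topspace (Euclidean_space d)\<rbrakk>
        \<Longrightarrow> {h \<in> space H. h x = h y} \<in> sets H"
    and near_collision:
      "\<lbrakk>x \<in> topspace (Euclidean_space d); y \<in> topspace (Euclidean_space d); edist d x y \<le> r\<rbrakk>
        \<Longrightarrow> p_near \<le> prob {h \<in> space H. h x = h y}"
    and far_collision:
      "\<lbrakk>x \<in> topspace (Euclidean_space d); y \<in> topspace (Euclidean_space d);
        1 \<le> c; c \<le> log 2 (real n) powr (1 / 7); c * r \<le> edist d x y\<rbrakk>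
        \<Longrightarrow> prob {h \<in> space H. h x = h y} \<le> p_near powr (c\<^sup>2 * (1 - \<alpha>))"
    and p_near_lower: "exp (- B * sqrt (log 2 (real n) powr (2 / 3))) \<le> p_near"
    and p_near_upper: "p_near \<le> exp (- b)"
    and eval_time: "0 \<le> \<tau>" "\<tau> \<le> real n powr \<eta>"

definition bernoulli_sample :: "'a set \<Rightarrow> real \<Rightarrow> 'a set pmf" where
  "bernoulli_sample P s =
     map_pmf (\<lambda>keep. {x \<in> P. keep x}) (Pi_pmf P False (\<lambda>_. bernoulli_pmf s))"

text \<open>
  An instance of the problem together with the hash families used for it. \<open>H j\<close>, \<open>p_near j\<close>
  and \<open>\<tau> j\<close> are the family for level \<open>j\<close>, its near collision probability and its evaluation
  time; \<open>\<sigma>\<close> is the time to process one stored point (read it, compute its weight and level,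
  add its contribution to the output), and also to look up a bucket.
  \<open>\<alpha>\<close>, \<open>\<beta>\<close>, \<open>\<eta>\<close> are the values at \<open>n\<close> of the \<open>o(1)\<close> terms in \<open>c\<^sup>2(1 - o(1))\<close>, in
  \<open>\<mu>\<^bsup>-o(1)\<^esup>\<close> and in the \<open>n\<^bsup>o(1)\<^esup>\<close> time bounds; \<open>A\<close> is the exponent in \<open>\<mu> = n\<^bsup>-O(1)\<^esup>\<close>, without
  which \<open>\<mu>\<^bsup>-o(1)\<^esup>\<close> is not \<open>n\<^bsup>o(1)\<^esup>\<close>.
\<close>

locale kde_instance =
  fixes A B b C :: real and \<alpha> \<beta> \<eta> :: real
    and n d :: nat and P :: "(nat \<Rightarrow> real) set" and q :: "nat \<Rightarrow> real"
    and f :: "real \<Rightarrow> real" and \<mu> \<epsilon> :: real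
    and H :: "nat \<Rightarrow> ((nat \<Rightarrow> real) \<Rightarrow> 'b) measure" and p_near \<tau> :: "nat \<Rightarrow> real" and \<sigma> :: real
  assumes points: "P \<subseteq> topspace (Euclidean_space d)" "finite P" "card P = n"
    and query_point: "q \<in> topspace (Euclidean_space d)"
    and kernel_nonneg: "\<And>x. 0 \<le> x \<Longrightarrow> 0 \<le> f x"
    and kernel_decreasing: "antimono_on {0..} f"
    and density_le: "(\<Sum>x\<in>P. f (edist d x q)) / real n \<le> \<mu>"
    and density_range: "real n powr (- A) \<le> \<mu>" "\<mu> < 1"
    and precision: "0 < \<epsilon>" "\<epsilon> \<le> 1"
    and radius_defined:
      "\<And>j. j \<in> {1..num_levels \<mu>} \<Longrightarrow> radius_set f j \<noteq> {}"
      "\<And>j. j \<in> {1..num_levels \<mu>} \<Longrightarrow> bdd_above (radius_set f j)"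
      "\<And>j. j \<in> {1..num_levels \<mu>} \<Longrightarrow> 0 < radius f j"
    and lsh: "\<And>j. j \<in> {1..num_levels \<mu>} \<Longrightarrow>
      andoni_indyk_lsh (H j) n d \<alpha> \<eta> B b (radius f j) (p_near j) (\<tau> j)"
    and point_time: "0 \<le> \<sigma>" "\<sigma> \<le> real n powr \<eta>"
begin

definition weight :: "(nat \<Rightarrow> real) \<Rightarrow> real" where
  "weight x = f (edist d x q)"

definition level :: "nat \<Rightarrow> (nat \<Rightarrow> real) set" where
  "level j = {x \<in> P. weight x \<in> band j}"

definition last_level :: "(nat \<Rightarrow> real) set" where
  "last_level = P - (\<Union>j\<in>{1..num_levels \<mu>}. level j)"

definition sample_prob :: "nat \<Rightarrow> real" where
  "sample_prob j = min (1 / (2 ^ j * real n * \<mu>)) 1"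

text \<open>The numbers \<open>k\<^sub>j\<close>, \<open>K\<^sub>1\<close> and \<open>K\<^sub>2\<close> are rounded up to integers.\<close>

definition concat_len :: "nat \<Rightarrow> nat" where
  "concat_len j =
     nat \<lceil>- 1 / log 2 (p_near j) * real_of_int (cost_exponent n \<alpha> f \<mu> j)\<rceil>"

definition num_reps :: nat where
  "num_reps = nat \<lceil>C * log 2 (real n) / \<epsilon>\<^sup>2 * \<mu> powr (- \<beta>)\<rceil>"

definition num_tables :: "nat \<Rightarrow> nat" where
  "num_tables j = nat \<lceil>100 * log 2 (real n) * p_near j powr (- real (concat_len j))\<rceil>"

text \<open>
  The random choices of the preprocessing. For repetition \<open>a\<close>, the component \<open>fst (\<omega> a) j\<close> is the
  sample for level \<open>j\<close> together with the hash functions indexed by \<open>(l, m)\<close>, the \<open>m\<close>-th of the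
  functions concatenated for table \<open>l\<close>; the component \<open>snd (\<omega> a)\<close> is the sample with rate \<open>1/n\<close>.
\<close>

definition level_space ::
    "nat \<Rightarrow> ((nat \<Rightarrow> real) set \<times> (nat \<times> nat \<Rightarrow> (nat \<Rightarrow> real) \<Rightarrow> 'b)) measure" where
  "level_space j = measure_pmf (bernoulli_sample P (sample_prob j))
     \<Otimes>\<^sub>M (\<Pi>\<^sub>M lm\<in>{..<num_tables j} \<times> {..<concat_len j}. H j)"

definition preprocessing_space ::
    "(nat \<Rightarrow> (nat \<Rightarrow> (nat \<Rightarrow> real) set \<times> (nat \<times> nat \<Rightarrow> (nat \<Rightarrow> real) \<Rightarrow> 'b))
       \<times> (nat \<Rightarrow> real) set) measure" where
  "preprocessing_space =
     (\<Pi>\<^sub>M a\<in>{..<num_reps}. (\<Pi>\<^sub>M j\<in>{1..num_levels \<mu>}. level_space j)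
        \<Otimes>\<^sub>M measure_pmf (bernoulli_sample P (1 / real n)))"

text \<open>
  The samples are almost surely subsets of \<open>P\<close>; repeating \<open>x \<in> P\<close> here keeps the bucket size
  measurable on the whole product space.
\<close>

definition bucket ::
    "nat \<Rightarrow> (nat \<Rightarrow> real) set \<times> (nat \<times> nat \<Rightarrow> (nat \<Rightarrow> real) \<Rightarrow> 'b) \<Rightarrow> nat \<Rightarrow> (nat \<Rightarrow> real) set" where
  "bucket j D l = {x \<in> P. x \<in> fst D \<and> (\<forall>m<concat_len j. snd D (l, m) x = snd D (l, m) q)}"

definition recovered ::
    "(nat \<Rightarrow> (nat \<Rightarrow> real) set \<times> (nat \<times> nat \<Rightarrow> (nat \<Rightarrow> real) \<Rightarrow> 'b)) \<times> (nat \<Rightarrow> real) set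
       \<Rightarrow> (nat \<Rightarrow> real) set" where
  "recovered R = (\<Union>j\<in>{1..num_levels \<mu>}. \<Union>l<num_tables j. bucket j (fst R j) l \<inter> level j)
     \<union> (snd R \<inter> last_level)"

definition estimate ::
    "(nat \<Rightarrow> (nat \<Rightarrow> real) set \<times> (nat \<times> nat \<Rightarrow> (nat \<Rightarrow> real) \<Rightarrow> 'b)) \<times> (nat \<Rightarrow> real) set
       \<Rightarrow> real" where
  "estimate R =
     (\<Sum>j\<in>{1..num_levels \<mu>}. \<Sum>x\<in>recovered R \<inter> level j. weight x / sample_prob j)
     + (\<Sum>x\<in>recovered R \<inter> last_level. weight x / (1 / real n))"

definition rep_time ::
    "(nat \<Rightarrow> (nat \<Rightarrow> real) set \<times> (nat \<times> nat \<Rightarrow> (nat \<Rightarrow> real) \<Rightarrow> 'b)) \<times> (nat \<Rightarrow> real) set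
       \<Rightarrow> real" where
  "rep_time R =
     (\<Sum>j\<in>{1..num_levels \<mu>}. \<Sum>l<num_tables j.
        real (concat_len j) * \<tau> j + (1 + real (card (bucket j (fst R j) l))) * \<sigma>)
     + real (card (snd R)) * \<sigma> + real (card (recovered R)) * \<sigma>"

text \<open>The outputs \<open>Z\<^sub>a\<close> of the query, and its running time.\<close>

definition query ::
    "(nat \<Rightarrow> (nat \<Rightarrow> (nat \<Rightarrow> real) set \<times> (nat \<times> nat \<Rightarrow> (nat \<Rightarrow> real) \<Rightarrow> 'b))
       \<times> (nat \<Rightarrow> real) set) \<Rightarrow> real list \<times> real" where
  "query \<omega> = (map (\<lambda>a. estimate (\<omega> a)) [0..<num_reps], \<Sum>a<num_reps. rep_time (\<omega> a))"

definition query_time ::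
    "(nat \<Rightarrow> (nat \<Rightarrow> (nat \<Rightarrow> real) set \<times> (nat \<times> nat \<Rightarrow> (nat \<Rightarrow> real) \<Rightarrow> 'b))
       \<times> (nat \<Rightarrow> real) set) \<Rightarrow> real" where
  "query_time \<omega> = snd (query \<omega>)"

end

end

theory Submission
  imports Defs "HOL-Real_Asymp.Real_Asymp"
begin

text \<open>
  Fix a level \<open>j\<close>. A point of weight at most \<open>2\<^bsup>1-i\<^esup>\<close> with \<open>i > j\<close> lies at distance at least
  \<open>r\<^bsub>i-1\<^esub> \<ge> c\<^bsub>i,j\<^esub> r\<^sub>j\<close> from the query, and \<open>k\<^sub>j\<close> is chosen so that it collides with the query under
  all \<open>k\<^sub>j\<close> functions with probability at most \<open>2\<^bsup>j-i\<^esup>\<close>. Taking for \<open>i\<close> the weight class of the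
  point \<open>x\<close>, its collision probability is at most \<open>2\<^sup>j max {w(x), 2\<^bsup>-(J+1)\<^esup>}\<close>. The sampling rate is
  at most \<open>1 / (2\<^sup>j n\<mu>)\<close>, the weights sum to at most \<open>n\<mu>\<close> and \<open>2\<^bsup>-J\<^esup> \<le> \<mu>\<close>, so a bucket holds at most
  two points in expectation. The time is therefore governed by the number of tables
  \<open>p\<^bsup>-k\<^esup> \<le> cost / p\<close>, where rounding \<open>k\<^sub>j\<close> up loses only the factor \<open>1 / p = n\<^bsup>o(1)\<^esup>\<close>.
\<close>

section \<open>Random sets and product spaces\<close>

lemma
  fixes g :: "'b \<Rightarrow> 'c :: {banach, second_countable_topology}"
  assumes "T \<in> measurable M N" "distr M N T = N" "integrable N g"
  shows integrable_marginal: "integrable M (\<lambda>x. g (T x))"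
    and integral_marginal: "(\<integral>x. g (T x) \<partial>M) = (\<integral>y. g y \<partial>N)"
  using integrable_distr[OF assms(1), of g] integral_distr[OF assms(1), of g] assms(2,3) by auto

context prob_space
begin

lemma
  assumes "finite A" and events: "\<And>x. x \<in> A \<Longrightarrow> {\<omega> \<in> space M. x \<in> X \<omega>} \<in> events"
  shows integrable_card_Int: "integrable M (\<lambda>\<omega>. real (card (A \<inter> X \<omega>)))"
    and expectation_card_Int:
      "expectation (\<lambda>\<omega>. real (card (A \<inter> X \<omega>))) = (\<Sum>x\<in>A. prob {\<omega> \<in> space M. x \<in> X \<omega>})"
proof -
  let ?member = "\<lambda>x. indicator {\<omega> \<in> space M. x \<in> X \<omega>} :: 'a \<Rightarrow> real"
  have card: "real (card (A \<inter> X \<omega>)) = (\<Sum>x\<in>A. ?member x \<omega>)" if "\<omega> \<in> space M" for \<omega>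
    using that assms(1) by (simp add: indicator_def sum.If_cases Int_def)
  have integrable: "integrable M (?member x)" if "x \<in> A" for x
    using events[OF that] by (intro integrable_real_indicator) (auto simp: emeasure_eq_measure)
  show "integrable M (\<lambda>\<omega>. real (card (A \<inter> X \<omega>)))"
    using integrable by (simp add: card cong: Bochner_Integration.integrable_cong)
  have "expectation (\<lambda>\<omega>. real (card (A \<inter> X \<omega>))) = expectation (\<lambda>\<omega>. \<Sum>x\<in>A. ?member x \<omega>)"
    by (rule Bochner_Integration.integral_cong[OF refl card])
  also have "\<dots> = (\<Sum>x\<in>A. expectation (?member x))"
    by (rule Bochner_Integration.integral_sum[OF integrable])
  also have "\<dots> = (\<Sum>x\<in>A. prob {\<omega> \<in> space M. x \<in> X \<omega>})"
    using events by (intro sum.cong) auto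
  finally show "expectation (\<lambda>\<omega>. real (card (A \<inter> X \<omega>)))
      = (\<Sum>x\<in>A. prob {\<omega> \<in> space M. x \<in> X \<omega>})" .
qed

lemma prob_PiM_all_mem:
  assumes "J \<subseteq> I" "finite J" "A \<in> events"
  shows "measure (\<Pi>\<^sub>M i\<in>I. M) {\<omega> \<in> space (\<Pi>\<^sub>M i\<in>I. M). \<forall>i\<in>J. \<omega> i \<in> A} = prob A ^ card J"
proof -
  interpret product: product_prob_space "\<lambda>_. M" I ..
  have "emeasure (\<Pi>\<^sub>M i\<in>I. M) {\<omega> \<in> space (\<Pi>\<^sub>M i\<in>I. M). \<forall>i\<in>J. \<omega> i \<in> A} = (\<Prod>i\<in>J. emeasure M A)"
    using assms by (intro product.emeasure_PiM_Collect) auto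
  then show ?thesis by (simp add: product.emeasure_eq_measure emeasure_eq_measure ennreal_power)
qed

lemma distr_pair_snd:
  assumes "sigma_finite_measure N"
  shows "distr (M \<Otimes>\<^sub>M N) N snd = N"
proof (rule measure_eqI)
  interpret N: sigma_finite_measure N by fact
  fix X assume "X \<in> sets (distr (M \<Otimes>\<^sub>M N) N snd)"
  then have X: "X \<in> sets N" by simp
  then have "snd -` X \<inter> space (M \<Otimes>\<^sub>M N) = space M \<times> X"
    by (auto simp: space_pair_measure dest: sets.sets_into_space)
  with X show "emeasure (distr (M \<Otimes>\<^sub>M N) N snd) X = emeasure N X"
    by (simp add: emeasure_distr N.emeasure_pair_measure_Times emeasure_space_1)
qed simp

end

section \<open>Bernoulli samples\<close>

lemma bernoulli_sample_subset: "S \<in> set_pmf (bernoulli_sample P s) \<Longrightarrow> S \<subseteq> P"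
  by (auto simp: bernoulli_sample_def)

lemma prob_mem_bernoulli_sample:
  assumes "finite P" "x \<in> P" "0 \<le> s" "s \<le> 1"
  shows "measure_pmf.prob (bernoulli_sample P s) {S. x \<in> S} = s"
proof -
  have "measure_pmf.prob (bernoulli_sample P s) {S. x \<in> S}
      = measure_pmf.prob (map_pmf (\<lambda>g. g x) (Pi_pmf P False (\<lambda>_. bernoulli_pmf s))) {True}"
    using assms by (simp add: bernoulli_sample_def vimage_def)
  also have "\<dots> = s"
    using assms by (simp add: Pi_pmf_component measure_pmf_single)
  finally show ?thesis .
qed

lemma
  assumes "finite P" "0 \<le> s" "s \<le> 1"
  shows integrable_card_bernoulli_sample:
      "integrable (bernoulli_sample P s) (\<lambda>S. real (card S))"
    and expectation_card_bernoulli_sample: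
      "measure_pmf.expectation (bernoulli_sample P s) (\<lambda>S. real (card S)) = real (card P) * s"
proof -
  have Int: "AE S in bernoulli_sample P s. real (card (P \<inter> S)) = real (card S)"
    by (rule AE_pmfI) (simp add: bernoulli_sample_subset Int_absorb1)
  show "integrable (bernoulli_sample P s) (\<lambda>S. real (card S))"
    using measure_pmf.integrable_card_Int[OF assms(1), of "bernoulli_sample P s" "\<lambda>S. S"]
      integrable_cong_AE[OF _ _ Int] by simp
  show "measure_pmf.expectation (bernoulli_sample P s) (\<lambda>S. real (card S)) = real (card P) * s"
    using measure_pmf.expectation_card_Int[OF assms(1), of "bernoulli_sample P s" "\<lambda>S. S"]
      integral_cong_AE[OF _ _ Int] prob_mem_bernoulli_sample[OF assms(1)] assms by simp
qed

section \<open>Weight and distance levels\<close>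

lemma num_levels_pos:
  assumes "0 < \<mu>" "\<mu> < 1" shows "1 \<le> num_levels \<mu>"
proof -
  have "0 < log 2 (1 / \<mu>)" using assms by simp
  then show ?thesis unfolding num_levels_def by linarith
qed

lemma two_powr_num_levels_le:
  assumes "0 < \<mu>" shows "2 powr (- real (num_levels \<mu>)) \<le> \<mu>"
proof -
  have "log 2 (1 / \<mu>) \<le> real (num_levels \<mu>)" by (simp add: num_levels_def) linarith
  then have "- real (num_levels \<mu>) \<le> log 2 \<mu>" using assms by (simp add: log_divide)
  then show ?thesis using assms by (simp add: le_log_iff)
qed

lemma powr_minus_less_1_imp_pos:
  fixes A :: real
  assumes "1 < m" "m powr (- A) < 1"
  shows "0 < A"
proof (rule ccontr)
  assume "\<not> 0 < A"
  then have "1 \<le> m powr (- A)" using assms by (intro ge_one_powr_ge_zero) auto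
  then show False using assms by simp
qed

lemma num_levels_le:
  assumes "2 \<le> n" "real n powr (- A) \<le> \<mu>" "\<mu> < 1"
  shows "real (num_levels \<mu>) \<le> (A + 1) * log 2 (real n)"
proof -
  have "0 < real n powr (- A)" using assms(1) by simp
  then have \<mu>: "0 < \<mu>" using assms(2) by linarith
  have "log 2 (real n powr (- A)) \<le> log 2 \<mu>"
    using assms by (intro log_mono) auto
  then have "log 2 (1 / \<mu>) \<le> A * log 2 (real n)"
    using assms(1) \<mu> by (simp add: log_powr log_divide)
  moreover have "0 < log 2 (1 / \<mu>)" using \<mu> assms(3) by simp
  then have "real (num_levels \<mu>) \<le> log 2 (1 / \<mu>) + 1"
    unfolding num_levels_def by linarith
  moreover have "1 \<le> log 2 (real n)" using assms(1) by simp
  ultimately show ?thesis by (simp add: distrib_right)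
qed

lemma dyadic_class_exists:
  fixes w :: real
  assumes "2 powr (- real m) \<le> w"
  shows "\<exists>i\<le>m. 2 powr (- real i) \<le> w \<and> (0 < i \<longrightarrow> w \<le> 2 powr (1 - real i))"
proof (intro exI conjI impI)
  let ?i = "LEAST i :: nat. 2 powr (- real i) \<le> w"
  show "?i \<le> m" using assms by (rule Least_le)
  show "2 powr (- real ?i) \<le> w" using assms by (rule LeastI)
  assume "0 < ?i"
  then have "\<not> 2 powr (- real (?i - 1)) \<le> w" by (intro not_less_Least) simp
  then show "w \<le> 2 powr (1 - real ?i)" using \<open>0 < ?i\<close> by (simp add: of_nat_diff)
qed

lemma radius_le:
  assumes "antimono_on {0..} f" "radius_set f j \<noteq> {}" "0 \<le> x" "f x \<le> 2 powr (- real j)"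
  shows "radius f j \<le> x"
  unfolding radius_def
proof (rule cSup_least)
  fix r assume "r \<in> radius_set f j"
  then have r: "0 \<le> r" "f x < f r" using assms(4) by (auto simp: radius_set_def band_def)
  show "r \<le> x"
  proof (rule ccontr)
    assume "\<not> r \<le> x"
    then have "f r \<le> f x" using assms(1,3) r(1) by (auto simp: monotone_on_def)
    then show False using r(2) by simp
  qed
qed fact

lemma radius_mono:
  assumes "antimono_on {0..} f" "radius_set f j \<noteq> {}"
    and "radius_set f i \<noteq> {}" "bdd_above (radius_set f i)" "j \<le> i"
  shows "radius f j \<le> radius f i"
proof (cases "j = i")
  case False
  obtain x where x: "x \<in> radius_set f i" using assms(3) by blast
  have "f x \<le> 2 powr (1 - real i)" using x by (simp add: radius_set_def band_def)
  also have "\<dots> \<le> 2 powr (- real j)" using False assms(5) by simp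
  finally have "radius f j \<le> x"
    using assms(1,2) x by (intro radius_le) (auto simp: radius_set_def)
  also have "x \<le> radius f i"
    unfolding radius_def by (rule cSup_upper[OF x assms(4)])
  finally show ?thesis .
qed simp

locale nondegenerate_kde_instance =
  kde_instance A B b C \<alpha> \<beta> \<eta> n d P q f \<mu> \<epsilon> H p_near \<tau> \<sigma>
  for A B b C \<alpha> \<beta> \<eta> n d P q f \<mu> \<epsilon>
    and H :: "nat \<Rightarrow> ((nat \<Rightarrow> real) \<Rightarrow> 'b) measure" and p_near \<tau> \<sigma> +
  assumes b_pos: "0 < b" and two_le_n: "2 \<le> n" and \<alpha>_less_1: "\<alpha> < 1"
begin

abbreviation J :: nat where "J \<equiv> num_levels \<mu>"

lemma log_n_ge_1: "1 \<le> log 2 (real n)"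
  using two_le_n by simp

lemma A_pos: "0 < A"
  using powr_minus_less_1_imp_pos[of "real n" A] density_range two_le_n by linarith

lemma mu_pos: "0 < \<mu>"
proof -
  have "0 < real n powr (- A)" using two_le_n by simp
  then show ?thesis using density_range(1) by linarith
qed

lemma weight_nonneg: "0 \<le> weight x"
  by (simp add: weight_def edist_def L2_set_nonneg kernel_nonneg)

lemma sum_weight_le: "(\<Sum>x\<in>P. weight x) \<le> real n * \<mu>"
  using density_le two_le_n by (simp add: weight_def field_simps)

lemma ratio_ge_1:
  assumes "j \<in> {1..J}" "i \<in> {j + 1..J + 1}"
  shows "1 \<le> ratio n f i j"
proof -
  have "radius f j \<le> radius f (i - 1)"
    using assms by (intro radius_mono kernel_decreasing radius_defined) auto
  then have "1 \<le> radius f (i - 1) / radius f j"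
    using radius_defined(3)[OF assms(1)] by simp
  moreover have "1 \<le> log 2 (real n) powr (1 / 7)"
    using log_n_ge_1 by (intro ge_one_powr_ge_zero) auto
  ultimately show ?thesis by (simp add: ratio_def)
qed

lemma cost_denominator_ge:
  assumes "j \<in> {1..J}" "i \<in> {j + 1..J + 1}"
  shows "1 - \<alpha> \<le> (ratio n f i j)\<^sup>2 * (1 - \<alpha>)"
  using mult_right_mono[of 1 "(ratio n f i j)\<^sup>2" "1 - \<alpha>"] ratio_ge_1[OF assms] \<alpha>_less_1 by simp

lemma cost_exponent_ge:
  assumes "j \<in> {1..J}" "i \<in> {j + 1..J + 1}"
  shows "real i - real j
    \<le> (ratio n f i j)\<^sup>2 * (1 - \<alpha>) * real_of_int (cost_exponent n \<alpha> f \<mu> j)"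
proof -
  have "\<lceil>(real i - real j) / ((ratio n f i j)\<^sup>2 * (1 - \<alpha>))\<rceil> \<le> cost_exponent n \<alpha> f \<mu> j"
    unfolding cost_exponent_def using assms by (intro Max_ge) auto
  then have "(real i - real j) / ((ratio n f i j)\<^sup>2 * (1 - \<alpha>))
      \<le> real_of_int (cost_exponent n \<alpha> f \<mu> j)" by linarith
  moreover have "0 < (ratio n f i j)\<^sup>2 * (1 - \<alpha>)"
    using cost_denominator_ge[OF assms] \<alpha>_less_1 by linarith
  ultimately show ?thesis by (simp add: pos_divide_le_eq mult.commute)
qed

lemma cost_exponent_nonneg:
  assumes "j \<in> {1..J}"
  shows "0 \<le> cost_exponent n \<alpha> f \<mu> j"
proof -
  have i: "j + 1 \<in> {j + 1..J + 1}" using assms by auto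
  have "0 < (ratio n f (j + 1) j)\<^sup>2 * (1 - \<alpha>)"
    using cost_denominator_ge[OF assms i] \<alpha>_less_1 by linarith
  moreover have "0 < (ratio n f (j + 1) j)\<^sup>2 * (1 - \<alpha>) * real_of_int (cost_exponent n \<alpha> f \<mu> j)"
    using cost_exponent_ge[OF assms i] by linarith
  ultimately have "0 < real_of_int (cost_exponent n \<alpha> f \<mu> j)" by (rule zero_less_mult_pos[rotated])
  then show ?thesis by simp
qed

lemma cost_exponent_le:
  assumes "\<alpha> \<le> 1 / 2" "j \<in> {1..J}"
  shows "cost_exponent n \<alpha> f \<mu> j \<le> 2 * int J"
proof -
  have "\<lceil>(real i - real j) / ((ratio n f i j)\<^sup>2 * (1 - \<alpha>))\<rceil> \<le> 2 * int J"
    if i: "i \<in> {j + 1..J + 1}" for i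
  proof -
    have "1 / 2 \<le> (ratio n f i j)\<^sup>2 * (1 - \<alpha>)"
      using cost_denominator_ge[OF assms(2) i] assms(1) by linarith
    then have "(real i - real j) / ((ratio n f i j)\<^sup>2 * (1 - \<alpha>)) \<le> (real i - real j) / (1 / 2)"
      using i by (intro divide_left_mono) auto
    also have "\<dots> \<le> 2 * real J" using i assms(2) by simp
    finally show ?thesis by linarith
  qed
  then show ?thesis unfolding cost_exponent_def using assms(2) by (subst Max_le_iff) auto
qed

lemma level_cost_le_kernel_cost:
  "j \<in> {1..J} \<Longrightarrow> level_cost n \<alpha> f \<mu> j \<le> kernel_cost n \<alpha> f \<mu>"
  unfolding kernel_cost_def by (intro Max_ge) auto

end

section \<open>Near collisions\<close>

definition near_loss_exponent :: "real \<Rightarrow> nat \<Rightarrow> real" where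
  "near_loss_exponent B n = B * (sqrt (log 2 (real n) powr (2 / 3)) / ln (real n))"

lemma near_loss_exponent_tendsto_0: "near_loss_exponent B \<longlonglongrightarrow> 0"
proof -
  have "(\<lambda>n. sqrt (log 2 (real n) powr (2 / 3)) / ln (real n)) \<longlonglongrightarrow> 0" by real_asymp
  then have "(\<lambda>n. B * (sqrt (log 2 (real n) powr (2 / 3)) / ln (real n))) \<longlonglongrightarrow> B * 0"
    by (rule tendsto_mult_left)
  then show ?thesis by (simp add: near_loss_exponent_def[abs_def])
qed

lemma powr_near_loss_exponent:
  "2 \<le> n \<Longrightarrow> real n powr near_loss_exponent B n = exp (B * sqrt (log 2 (real n) powr (2 / 3)))"
  by (simp add: powr_def near_loss_exponent_def)

context nondegenerate_kde_instance
begin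

definition near_bits :: "nat \<Rightarrow> real" where
  "near_bits j = - log 2 (p_near j)"

lemma
  assumes "j \<in> {1..J}"
  shows p_near_ge: "exp (- B * sqrt (log 2 (real n) powr (2 / 3))) \<le> p_near j"
    and p_near_le: "p_near j \<le> exp (- b)"
    and p_near_pos: "0 < p_near j"
proof -
  interpret andoni_indyk_lsh "H j" n d \<alpha> \<eta> B b "radius f j" "p_near j" "\<tau> j"
    by (rule lsh[OF assms])
  show "exp (- B * sqrt (log 2 (real n) powr (2 / 3))) \<le> p_near j" by (rule p_near_lower)
  then show "0 < p_near j" using exp_gt_zero less_le_trans by blast
  show "p_near j \<le> exp (- b)" by (rule p_near_upper)
qed

lemma p_near_powr:
  assumes "j \<in> {1..J}"
  shows "p_near j powr t = 2 powr (- (t * near_bits j))"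
proof -
  have "p_near j powr t = (2 powr log 2 (p_near j)) powr t" using p_near_pos[OF assms] by simp
  also have "\<dots> = 2 powr (- (t * near_bits j))"
    by (simp only: powr_powr near_bits_def) (simp add: mult.commute)
  finally show ?thesis .
qed

lemma near_bits_ge:
  assumes "j \<in> {1..J}"
  shows "b \<le> near_bits j"
proof -
  have "p_near j \<le> exp (- b)" by (rule p_near_le[OF assms])
  also have "\<dots> \<le> 2 powr (- b)"
    using b_pos ln_2_less_1 by (simp add: powr_def mult_left_le)
  finally have "log 2 (p_near j) \<le> - b"
    using p_near_pos[OF assms] by (simp add: log_le_iff)
  then show ?thesis by (simp add: near_bits_def)
qed

lemma near_bits_pos: "j \<in> {1..J} \<Longrightarrow> 0 < near_bits j"
  using near_bits_ge b_pos less_le_trans by blast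

lemma two_powr_near_bits_le:
  assumes "j \<in> {1..J}"
  shows "2 powr near_bits j \<le> real n powr near_loss_exponent B n"
proof -
  have "2 powr near_bits j = 1 / p_near j"
    using p_near_powr[OF assms, of "- 1"] p_near_pos[OF assms] by (simp add: powr_minus_divide)
  also have "\<dots> \<le> 1 / exp (- B * sqrt (log 2 (real n) powr (2 / 3)))"
    using p_near_ge[OF assms] p_near_pos[OF assms] by (intro divide_left_mono) auto
  also have "\<dots> = real n powr near_loss_exponent B n"
    using two_le_n by (simp add: powr_near_loss_exponent exp_minus field_simps)
  finally show ?thesis .
qed

lemma
  assumes "j \<in> {1..J}"
  shows cost_exponent_le_concat_len:
      "real_of_int (cost_exponent n \<alpha> f \<mu> j) \<le> real (concat_len j) * near_bits j"
    and concat_len_le_cost_exponent: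
      "real (concat_len j) * near_bits j \<le> real_of_int (cost_exponent n \<alpha> f \<mu> j) + near_bits j"
proof -
  define E where "E = real_of_int (cost_exponent n \<alpha> f \<mu> j)"
  have "0 \<le> E / near_bits j"
    using cost_exponent_nonneg[OF assms] near_bits_pos[OF assms] by (simp add: E_def)
  moreover have "concat_len j = nat \<lceil>E / near_bits j\<rceil>"
    by (simp add: concat_len_def near_bits_def E_def)
  ultimately have "E / near_bits j \<le> real (concat_len j)" "real (concat_len j) \<le> E / near_bits j + 1"
    by linarith+
  then show "E \<le> real (concat_len j) * near_bits j"
    "real (concat_len j) * near_bits j \<le> E + near_bits j"
    using near_bits_pos[OF assms] by (auto simp: field_simps)
qed

section \<open>Expected size of a bucket\<close>

abbreviation collision_prob :: "nat \<Rightarrow> (nat \<Rightarrow> real) \<Rightarrow> real" where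
  "collision_prob j x \<equiv> measure (H j) {h \<in> space (H j). h x = h q}"

lemma prob_space_H: "j \<in> {1..J} \<Longrightarrow> prob_space (H j)"
  using lsh by (simp add: andoni_indyk_lsh_def)

lemma far_collision_prob_le:
  assumes "j \<in> {1..J}" "i \<in> {j + 1..J + 1}" "x \<in> P" "weight x \<le> 2 powr (1 - real i)"
  shows "collision_prob j x \<le> p_near j powr ((ratio n f i j)\<^sup>2 * (1 - \<alpha>))"
proof -
  interpret andoni_indyk_lsh "H j" n d \<alpha> \<eta> B b "radius f j" "p_near j" "\<tau> j"
    by (rule lsh[OF assms(1)])
  have "ratio n f i j * radius f j \<le> radius f (i - 1)"
    using radius_defined(3)[OF assms(1)] by (simp add: ratio_def flip: pos_le_divide_eq)
  also have "\<dots> \<le> edist d x q"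
    using assms by (intro radius_le kernel_decreasing radius_defined)
      (auto simp: weight_def edist_def L2_set_nonneg of_nat_diff)
  finally show ?thesis
    using points(1) query_point assms(3) ratio_ge_1[OF assms(1,2)]
    by (intro far_collision) (auto simp: ratio_def)
qed

lemma far_collision_prob_power_le:
  assumes "j \<in> {1..J}" "i \<in> {j + 1..J + 1}" "x \<in> P" "weight x \<le> 2 powr (1 - real i)"
  shows "collision_prob j x ^ concat_len j \<le> 2 powr (real j - real i)"
proof -
  let ?e = "(ratio n f i j)\<^sup>2 * (1 - \<alpha>)"
  have "real i - real j \<le> ?e * real_of_int (cost_exponent n \<alpha> f \<mu> j)"
    by (rule cost_exponent_ge[OF assms(1,2)])
  also have "\<dots> \<le> ?e * (real (concat_len j) * near_bits j)"
    using cost_exponent_le_concat_len[OF assms(1)] \<alpha>_less_1 by (intro mult_left_mono) auto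
  finally have exponent: "real i - real j \<le> ?e * real (concat_len j) * near_bits j"
    by (simp only: mult.assoc)
  have "collision_prob j x ^ concat_len j \<le> (p_near j powr ?e) ^ concat_len j"
    using far_collision_prob_le[OF assms] by (intro power_mono) auto
  also have "\<dots> = p_near j powr (?e * real (concat_len j))"
    using p_near_pos[OF assms(1)] by (simp add: powr_powr flip: powr_realpow)
  also have "\<dots> = 2 powr (- (?e * real (concat_len j) * near_bits j))"
    by (rule p_near_powr[OF assms(1)])
  also have "\<dots> \<le> 2 powr (real j - real i)" using exponent by simp
  finally show ?thesis .
qed

lemma collision_prob_power_le_weight:
  assumes "j \<in> {1..J}" "x \<in> P"
  shows "collision_prob j x ^ concat_len j
    \<le> 2 powr real j * max (weight x) (2 powr (- real (J + 1)))" (is "_ \<le> _ * ?w")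
proof -
  obtain i where i: "i \<le> J + 1" "2 powr (- real i) \<le> ?w" "0 < i \<Longrightarrow> ?w \<le> 2 powr (1 - real i)"
    using dyadic_class_exists[of "J + 1" ?w] by auto
  have "collision_prob j x ^ concat_len j \<le> 2 powr (real j - real i)"
  proof (cases "i \<le> j")
    case True
    have "collision_prob j x ^ concat_len j \<le> 1"
      using prob_space.prob_le_1[OF prob_space_H[OF assms(1)]] by (simp add: power_le_one)
    also have "\<dots> \<le> 2 powr (real j - real i)" using True by (intro ge_one_powr_ge_zero) auto
    finally show ?thesis .
  next
    case False
    then show ?thesis using assms i by (intro far_collision_prob_power_le) auto
  qed
  also have "\<dots> = 2 powr real j * 2 powr (- real i)" by (simp flip: powr_add)
  also have "\<dots> \<le> 2 powr real j * ?w" using i(2) by (intro mult_left_mono) auto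
  finally show ?thesis .
qed

lemma
  shows sample_prob_nonneg: "0 \<le> sample_prob j"
    and sample_prob_le_1: "sample_prob j \<le> 1"
    and sample_prob_le: "sample_prob j \<le> 1 / (2 powr real j * (real n * \<mu>))"
  using mu_pos by (auto simp: sample_prob_def powr_realpow mult_ac)

lemma expected_bucket_size_le_2:
  assumes "j \<in> {1..J}"
  shows "(\<Sum>x\<in>P. sample_prob j * collision_prob j x ^ concat_len j) \<le> 2"
proof -
  have n\<mu>: "0 < real n * \<mu>" using mu_pos two_le_n by simp
  have "2 powr (- real (J + 1)) \<le> 2 powr (- real J)" by simp
  also have "\<dots> \<le> \<mu>" by (rule two_powr_num_levels_le[OF mu_pos])
  finally have max_le: "max (weight x) (2 powr (- real (J + 1))) \<le> weight x + \<mu>" for x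
    using weight_nonneg[of x] mu_pos by linarith
  have "(\<Sum>x\<in>P. sample_prob j * collision_prob j x ^ concat_len j)
      \<le> (\<Sum>x\<in>P. 1 / (2 powr real j * (real n * \<mu>)) * (2 powr real j * (weight x + \<mu>)))"
  proof (intro sum_mono mult_mono sample_prob_le)
    fix x assume "x \<in> P"
    then have "collision_prob j x ^ concat_len j
        \<le> 2 powr real j * max (weight x) (2 powr (- real (J + 1)))"
      by (rule collision_prob_power_le_weight[OF assms])
    also have "\<dots> \<le> 2 powr real j * (weight x + \<mu>)" by (intro mult_left_mono max_le) simp
    finally show "collision_prob j x ^ concat_len j \<le> 2 powr real j * (weight x + \<mu>)" .
  qed (use n\<mu> in auto)
  also have "\<dots> = ((\<Sum>x\<in>P. weight x) + real n * \<mu>) / (real n * \<mu>)"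
    using points(3) by (simp add: sum.distrib flip: sum_divide_distrib)
  also have "\<dots> \<le> 2" using sum_weight_le n\<mu> by (simp add: divide_le_eq mult.commute)
  finally show ?thesis .
qed

definition hash_space :: "nat \<Rightarrow> (nat \<times> nat \<Rightarrow> (nat \<Rightarrow> real) \<Rightarrow> 'b) measure" where
  "hash_space j = (\<Pi>\<^sub>M lm\<in>{..<num_tables j} \<times> {..<concat_len j}. H j)"

definition table_collision ::
    "nat \<Rightarrow> nat \<Rightarrow> (nat \<Rightarrow> real) \<Rightarrow> (nat \<times> nat \<Rightarrow> (nat \<Rightarrow> real) \<Rightarrow> 'b) set" where
  "table_collision j l x = {h \<in> space (hash_space j). \<forall>m<concat_len j. h (l, m) x = h (l, m) q}"

lemma level_space_eq:
  "level_space j = measure_pmf (bernoulli_sample P (sample_prob j)) \<Otimes>\<^sub>M hash_space j"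
  by (simp add: level_space_def hash_space_def)

lemma prob_space_hash_space: "j \<in> {1..J} \<Longrightarrow> prob_space (hash_space j)"
  unfolding hash_space_def by (intro prob_space_PiM prob_space_H)

lemma prob_space_level_space: "j \<in> {1..J} \<Longrightarrow> prob_space (level_space j)"
  unfolding level_space_eq
  by (intro prob_space_pair prob_space_hash_space prob_space_measure_pmf)

lemma
  assumes "j \<in> {1..J}" "l < num_tables j" "x \<in> P"
  shows sets_table_collision: "table_collision j l x \<in> sets (hash_space j)"
    and prob_table_collision:
      "measure (hash_space j) (table_collision j l x) = collision_prob j x ^ concat_len j"
proof -
  interpret andoni_indyk_lsh "H j" n d \<alpha> \<eta> B b "radius f j" "p_near j" "\<tau> j"
    by (rule lsh[OF assms(1)])
  let ?I = "{..<num_tables j} \<times> {..<concat_len j}" and ?table = "{l} \<times> {..<concat_len j}"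
  let ?collide = "{h \<in> space (H j). h x = h q}"
  have table: "?table \<subseteq> ?I" "finite ?table" using assms(2) by auto
  have collide: "?collide \<in> events"
    using points(1) query_point assms(3) by (intro collision_event) auto
  have "h i \<in> space (H j)" if "h \<in> space (hash_space j)" "i \<in> ?table" for h i
    using that table(1) by (auto simp: hash_space_def space_PiM)
  then have all_collide:
    "table_collision j l x = {h \<in> space (hash_space j). \<forall>i\<in>?table. h i \<in> ?collide}"
    by (auto simp: table_collision_def)
  show "table_collision j l x \<in> sets (hash_space j)"
    unfolding all_collide unfolding hash_space_def using table collide
    by (intro sets.sets_Collect_finite_All sets_Collect_single) auto
  show "measure (hash_space j) (table_collision j l x) = collision_prob j x ^ concat_len j"
    unfolding all_collide unfolding hash_space_def
    by (simp only: prob_PiM_all_mem[OF table collide]) (simp add: card_cartesian_product)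
qed

lemma
  assumes "j \<in> {1..J}" "l < num_tables j" "x \<in> P"
  shows level_space_mem_bucket_event:
      "{D \<in> space (level_space j). x \<in> bucket j D l} \<in> sets (level_space j)"
    and level_space_prob_mem_bucket:
      "measure (level_space j) {D \<in> space (level_space j). x \<in> bucket j D l}
      = sample_prob j * collision_prob j x ^ concat_len j"
proof -
  interpret hash: prob_space "hash_space j" by (rule prob_space_hash_space[OF assms(1)])
  have event: "{D \<in> space (level_space j). x \<in> bucket j D l} = {S. x \<in> S} \<times> table_collision j l x"
    using assms(3)
    by (auto simp: level_space_eq space_pair_measure bucket_def table_collision_def)
  show "{D \<in> space (level_space j). x \<in> bucket j D l} \<in> sets (level_space j)"
    unfolding event unfolding level_space_eq
    using sets_table_collision[OF assms] by (intro pair_measureI) auto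
  have "measure (level_space j) ({S. x \<in> S} \<times> table_collision j l x)
      = measure_pmf.prob (bernoulli_sample P (sample_prob j)) {S. x \<in> S}
        * measure (hash_space j) (table_collision j l x)"
    unfolding level_space_eq using sets_table_collision[OF assms]
    by (simp add: measure_def hash.emeasure_pair_measure_Times enn2real_mult)
  also have "\<dots> = sample_prob j * collision_prob j x ^ concat_len j"
    using prob_mem_bernoulli_sample[OF points(2) assms(3) sample_prob_nonneg sample_prob_le_1]
    by (simp add: prob_table_collision[OF assms])
  finally show "measure (level_space j) {D \<in> space (level_space j). x \<in> bucket j D l}
      = sample_prob j * collision_prob j x ^ concat_len j"
    unfolding event .
qed

section \<open>Expected running time\<close>

definition rep_space ::
    "((nat \<Rightarrow> (nat \<Rightarrow> real) set \<times> (nat \<times> nat \<Rightarrow> (nat \<Rightarrow> real) \<Rightarrow> 'b)) \<times> (nat \<Rightarrow> real) set) measure" where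
  "rep_space = (\<Pi>\<^sub>M j\<in>{1..J}. level_space j) \<Otimes>\<^sub>M measure_pmf (bernoulli_sample P (1 / real n))"

lemma prob_space_rep_space: "prob_space rep_space"
  unfolding rep_space_def
  by (intro prob_space_pair prob_space_PiM prob_space_level_space prob_space_measure_pmf)

lemma measurable_rep_space_level:
  "j \<in> {1..J} \<Longrightarrow> (\<lambda>R. fst R j) \<in> measurable rep_space (level_space j)"
  unfolding rep_space_def by measurable

lemma measurable_rep_space_sample:
  "snd \<in> measurable rep_space (measure_pmf (bernoulli_sample P (1 / real n)))"
  unfolding rep_space_def by measurable

lemma distr_rep_space_level:
  assumes "j \<in> {1..J}"
  shows "distr rep_space (level_space j) (\<lambda>R. fst R j) = level_space j"
proof -
  let ?levels = "\<Pi>\<^sub>M j\<in>{1..J}. level_space j"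
  have "distr rep_space (level_space j) (\<lambda>R. fst R j)
      = distr (distr rep_space ?levels fst) (level_space j) (\<lambda>D. D j)"
    unfolding rep_space_def using assms by (subst distr_distr) (auto simp: comp_def)
  also have "distr rep_space ?levels fst = ?levels"
    unfolding rep_space_def by (rule measure_pmf.distr_pair_fst)
  also have "distr ?levels (level_space j) (\<lambda>D. D j) = level_space j"
    using assms by (intro distr_PiM_component prob_space_level_space)
  finally show ?thesis .
qed

lemma distr_rep_space_sample:
  "distr rep_space (measure_pmf (bernoulli_sample P (1 / real n))) snd
    = measure_pmf (bernoulli_sample P (1 / real n))"
  unfolding rep_space_def
  by (intro prob_space.distr_pair_snd prob_space_PiM prob_space_level_space
      measure_pmf.sigma_finite_measure_axioms)

lemma
  assumes "j \<in> {1..J}" "l < num_tables j" "x \<in> P"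
  shows rep_space_mem_bucket_event:
      "{R \<in> space rep_space. x \<in> bucket j (fst R j) l} \<in> sets rep_space"
    and rep_space_prob_mem_bucket:
      "measure rep_space {R \<in> space rep_space. x \<in> bucket j (fst R j) l}
      = sample_prob j * collision_prob j x ^ concat_len j"
proof -
  let ?E = "{D \<in> space (level_space j). x \<in> bucket j D l}"
  have vimage: "{R \<in> space rep_space. x \<in> bucket j (fst R j) l}
      = (\<lambda>R. fst R j) -` ?E \<inter> space rep_space"
    using measurable_space[OF measurable_rep_space_level[OF assms(1)]] by auto
  show "{R \<in> space rep_space. x \<in> bucket j (fst R j) l} \<in> sets rep_space"
    unfolding vimage
    by (rule measurable_sets[OF measurable_rep_space_level[OF assms(1)]
        level_space_mem_bucket_event[OF assms]])
  have "measure rep_space {R \<in> space rep_space. x \<in> bucket j (fst R j) l}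
      = measure (distr rep_space (level_space j) (\<lambda>R. fst R j)) ?E"
    unfolding vimage
    by (rule measure_distr[symmetric, OF measurable_rep_space_level[OF assms(1)]
        level_space_mem_bucket_event[OF assms]])
  also have "\<dots> = sample_prob j * collision_prob j x ^ concat_len j"
    unfolding distr_rep_space_level[OF assms(1)] by (rule level_space_prob_mem_bucket[OF assms])
  finally show "measure rep_space {R \<in> space rep_space. x \<in> bucket j (fst R j) l}
      = sample_prob j * collision_prob j x ^ concat_len j" .
qed

lemma bucket_subset: "bucket j D l \<subseteq> P"
  by (auto simp: bucket_def)

lemma
  assumes "j \<in> {1..J}" "l < num_tables j"
  shows integrable_card_bucket: "integrable rep_space (\<lambda>R. real (card (bucket j (fst R j) l)))"
    and expectation_card_bucket_le: "(\<integral>R. real (card (bucket j (fst R j) l)) \<partial>rep_space) \<le> 2"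
proof -
  interpret prob_space rep_space by (rule prob_space_rep_space)
  note events = rep_space_mem_bucket_event[OF assms]
  have Int: "P \<inter> bucket j D l = bucket j D l" for D
    by (rule Int_absorb1[OF bucket_subset])
  show "integrable rep_space (\<lambda>R. real (card (bucket j (fst R j) l)))"
    using integrable_card_Int[OF points(2) events] by (simp add: Int)
  show "(\<integral>R. real (card (bucket j (fst R j) l)) \<partial>rep_space) \<le> 2"
    using expectation_card_Int[OF points(2) events] rep_space_prob_mem_bucket[OF assms]
      expected_bucket_size_le_2[OF assms(1)] by (simp add: Int)
qed

lemma
  shows integrable_card_sample: "integrable rep_space (\<lambda>R. real (card (snd R)))"
    and expectation_card_sample: "(\<integral>R. real (card (snd R)) \<partial>rep_space) = 1"
proof -
  have rate: "0 \<le> 1 / real n" "1 / real n \<le> 1" using two_le_n by auto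
  note marginal = measurable_rep_space_sample distr_rep_space_sample
    integrable_card_bernoulli_sample[OF points(2) rate]
  show "integrable rep_space (\<lambda>R. real (card (snd R)))" by (rule integrable_marginal[OF marginal])
  show "(\<integral>R. real (card (snd R)) \<partial>rep_space) = 1"
    using integral_marginal[OF marginal] expectation_card_bernoulli_sample[OF points(2) rate]
      points(3) two_le_n by simp
qed

lemma AE_finite_sample: "AE R in rep_space. finite (snd R)"
proof -
  have "AE S in bernoulli_sample P (1 / real n). finite S"
    by (intro AE_pmfI finite_subset[OF bernoulli_sample_subset points(2)])
  then show ?thesis
    using AE_distrD[OF measurable_rep_space_sample] by (simp only: distr_rep_space_sample)
qed

lemma integrable_card_recovered: "integrable rep_space (\<lambda>R. real (card (recovered R)))"
proof -
  interpret prob_space rep_space by (rule prob_space_rep_space)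
  have "{R \<in> space rep_space. x \<in> recovered R} \<in> sets rep_space" if "x \<in> P" for x
  proof -
    have "Measurable.pred rep_space (\<lambda>R. x \<in> bucket j (fst R j) l)"
      if "j \<in> {1..J}" "l < num_tables j" for j l
      using rep_space_mem_bucket_event[OF that \<open>x \<in> P\<close>] by (simp add: pred_def)
    moreover have "Measurable.pred rep_space (\<lambda>R. x \<in> snd R)"
      by (rule measurable_compose[OF measurable_rep_space_sample]) simp
    ultimately have "Measurable.pred rep_space (\<lambda>R. (\<exists>j\<in>{1..J}. \<exists>l\<in>{..<num_tables j}.
        x \<in> bucket j (fst R j) l \<and> x \<in> level j) \<or> x \<in> snd R \<and> x \<in> last_level)"
      by (intro pred_intros_logic pred_intros_finite) auto
    then show ?thesis by (simp add: pred_def recovered_def)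
  qed
  then have "integrable rep_space (\<lambda>R. real (card (P \<inter> recovered R)))"
    by (intro integrable_card_Int points(2))
  moreover have "recovered R \<subseteq> P" for R
    by (auto simp: recovered_def bucket_def last_level_def)
  ultimately show ?thesis by (simp add: Int_absorb1)
qed

lemma card_recovered_le:
  assumes "finite (snd R)"
  shows "card (recovered R)
    \<le> (\<Sum>j\<in>{1..J}. \<Sum>l<num_tables j. card (bucket j (fst R j) l)) + card (snd R)"
proof -
  let ?scanned = "\<Union>j\<in>{1..J}. \<Union>l<num_tables j. bucket j (fst R j) l"
  have "card (recovered R) \<le> card (?scanned \<union> snd R)"
    using finite_subset[OF bucket_subset points(2)] assms
    by (intro card_mono) (auto simp: recovered_def)
  also have "\<dots> \<le> card ?scanned + card (snd R)" by (rule card_Un_le)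
  also have "card ?scanned \<le> (\<Sum>j\<in>{1..J}. card (\<Union>l<num_tables j. bucket j (fst R j) l))"
    by (rule card_UN_le) simp
  also have "\<dots> \<le> (\<Sum>j\<in>{1..J}. \<Sum>l<num_tables j. card (bucket j (fst R j) l))"
    by (intro sum_mono card_UN_le) simp
  finally show ?thesis by simp
qed

text \<open>Each point of a bucket is charged twice: for being scanned and for being output.\<close>

definition table_charge ::
    "nat \<Rightarrow> nat \<Rightarrow> (nat \<Rightarrow> (nat \<Rightarrow> real) set \<times> (nat \<times> nat \<Rightarrow> (nat \<Rightarrow> real) \<Rightarrow> 'b)) \<times> (nat \<Rightarrow> real) set
       \<Rightarrow> real" where
  "table_charge j l R
    = real (concat_len j) * \<tau> j + (1 + 2 * real (card (bucket j (fst R j) l))) * \<sigma>"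

lemma
  assumes "j \<in> {1..J}" "l < num_tables j"
  shows integrable_table_charge: "integrable rep_space (table_charge j l)"
    and expectation_table_charge_le:
      "(\<integral>R. table_charge j l R \<partial>rep_space) \<le> real (concat_len j) * \<tau> j + 5 * \<sigma>"
proof -
  interpret prob_space rep_space by (rule prob_space_rep_space)
  show "integrable rep_space (table_charge j l)"
    unfolding table_charge_def[abs_def] using integrable_card_bucket[OF assms] by simp
  have "expectation (table_charge j l) = real (concat_len j) * \<tau> j
      + (1 + 2 * expectation (\<lambda>R. real (card (bucket j (fst R j) l)))) * \<sigma>"
    unfolding table_charge_def[abs_def] using integrable_card_bucket[OF assms]
    by (simp add: prob_space)
  also have "\<dots> \<le> real (concat_len j) * \<tau> j + 5 * \<sigma>"
    using expectation_card_bucket_le[OF assms] point_time(1)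
    by (intro add_left_mono mult_right_mono) auto
  finally show "expectation (table_charge j l) \<le> real (concat_len j) * \<tau> j + 5 * \<sigma>" .
qed

lemma rep_time_le_charges:
  assumes "finite (snd R)"
  shows "rep_time R
    \<le> (\<Sum>j\<in>{1..J}. \<Sum>l<num_tables j. table_charge j l R) + 2 * real (card (snd R)) * \<sigma>"
proof -
  have charges: "(\<Sum>j\<in>{1..J}. \<Sum>l<num_tables j. table_charge j l R)
    = (\<Sum>j\<in>{1..J}. \<Sum>l<num_tables j.
        real (concat_len j) * \<tau> j + (1 + real (card (bucket j (fst R j) l))) * \<sigma>)
      + (\<Sum>j\<in>{1..J}. \<Sum>l<num_tables j. real (card (bucket j (fst R j) l))) * \<sigma>"
    by (simp only: sum_distrib_right flip: sum.distrib) (simp add: table_charge_def algebra_simps)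
  have "real (card (recovered R)) \<le> real ((\<Sum>j\<in>{1..J}. \<Sum>l<num_tables j.
      card (bucket j (fst R j) l)) + card (snd R))"
    using card_recovered_le[OF assms] by (simp only: of_nat_le_iff)
  then have "real (card (recovered R)) * \<sigma> \<le> ((\<Sum>j\<in>{1..J}. \<Sum>l<num_tables j.
      real (card (bucket j (fst R j) l))) + real (card (snd R))) * \<sigma>"
    using point_time(1) by (intro mult_right_mono) simp_all
  then show ?thesis
    unfolding charges rep_time_def by (simp add: algebra_simps)
qed

lemma integrable_rep_time: "integrable rep_space rep_time"
proof -
  interpret prob_space rep_space by (rule prob_space_rep_space)
  show ?thesis
    unfolding rep_time_def[abs_def]
    by (intro Bochner_Integration.integrable_add Bochner_Integration.integrable_sum
        integrable_mult_left integrable_const integrable_card_bucket integrable_card_sample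
        integrable_card_recovered) auto
qed

lemma expectation_rep_time_le_tables:
  "(\<integral>R. rep_time R \<partial>rep_space)
    \<le> (\<Sum>j\<in>{1..J}. real (num_tables j) * (real (concat_len j) * \<tau> j + 5 * \<sigma>)) + 2 * \<sigma>"
proof -
  have integrable_charges:
    "integrable rep_space (\<lambda>R. \<Sum>j\<in>{1..J}. \<Sum>l<num_tables j. table_charge j l R)"
    by (intro Bochner_Integration.integrable_sum integrable_table_charge) auto
  have integral_charges: "(\<integral>R. (\<Sum>j\<in>{1..J}. \<Sum>l<num_tables j. table_charge j l R) \<partial>rep_space)
      = (\<Sum>j\<in>{1..J}. \<Sum>l<num_tables j. \<integral>R. table_charge j l R \<partial>rep_space)"
    by (subst Bochner_Integration.integral_sum)
      (auto intro!: Bochner_Integration.integrable_sum integrable_table_charge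
        sum.cong Bochner_Integration.integral_sum)
  have "(\<integral>R. rep_time R \<partial>rep_space)
      \<le> (\<integral>R. (\<Sum>j\<in>{1..J}. \<Sum>l<num_tables j. table_charge j l R)
          + 2 * real (card (snd R)) * \<sigma> \<partial>rep_space)"
  proof (rule integral_mono_AE)
    show "AE R in rep_space. rep_time R
        \<le> (\<Sum>j\<in>{1..J}. \<Sum>l<num_tables j. table_charge j l R) + 2 * real (card (snd R)) * \<sigma>"
      using AE_finite_sample by eventually_elim (rule rep_time_le_charges)
  qed (use integrable_rep_time integrable_charges integrable_card_sample in auto)
  also have "\<dots> = (\<Sum>j\<in>{1..J}. \<Sum>l<num_tables j. \<integral>R. table_charge j l R \<partial>rep_space) + 2 * \<sigma>"
    unfolding integral_charges[symmetric]
    using integrable_charges integrable_card_sample expectation_card_sample by simp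
  also have "\<dots> \<le> (\<Sum>j\<in>{1..J}. \<Sum>l<num_tables j. real (concat_len j) * \<tau> j + 5 * \<sigma>) + 2 * \<sigma>"
    by (intro add_right_mono sum_mono expectation_table_charge_le) auto
  finally show ?thesis by simp
qed

lemma
  shows integrable_query_time: "integrable preprocessing_space query_time"
    and expectation_query_time:
      "(\<integral>\<omega>. query_time \<omega> \<partial>preprocessing_space) = real num_reps * (\<integral>R. rep_time R \<partial>rep_space)"
proof -
  have space: "preprocessing_space = (\<Pi>\<^sub>M a\<in>{..<num_reps}. rep_space)"
    by (simp add: preprocessing_space_def rep_space_def)
  have time: "query_time = (\<lambda>\<omega>. \<Sum>a<num_reps. rep_time (\<omega> a))"
    by (simp add: query_time_def query_def fun_eq_iff)
  have marginal: "(\<lambda>\<omega>. \<omega> a) \<in> measurable preprocessing_space rep_space"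
    "distr preprocessing_space rep_space (\<lambda>\<omega>. \<omega> a) = rep_space" if "a < num_reps" for a
    unfolding space using that distr_PiM_component[of "{..<num_reps}" "\<lambda>_. rep_space" a]
    by (auto simp: prob_space_rep_space)
  have integrable: "integrable preprocessing_space (\<lambda>\<omega>. rep_time (\<omega> a))" if "a < num_reps" for a
    by (rule integrable_marginal[OF marginal[OF that] integrable_rep_time])
  show "integrable preprocessing_space query_time"
    unfolding time using integrable by (intro Bochner_Integration.integrable_sum) auto
  show "(\<integral>\<omega>. query_time \<omega> \<partial>preprocessing_space) = real num_reps * (\<integral>R. rep_time R \<partial>rep_space)"
    unfolding time using integrable integral_marginal[OF marginal integrable_rep_time]
    by (simp add: Bochner_Integration.integral_sum)
qed

section \<open>Parameter bounds\<close>

definition table_cost :: real where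
  "table_cost = real n powr near_loss_exponent B n * kernel_cost n \<alpha> f \<mu>"

lemma
  assumes "j \<in> {1..J}"
  shows p_near_powr_concat_len_ge: "1 \<le> p_near j powr (- real (concat_len j))"
    and p_near_powr_concat_len_le: "p_near j powr (- real (concat_len j)) \<le> table_cost"
proof -
  have powr_eq: "p_near j powr (- real (concat_len j)) = 2 powr (real (concat_len j) * near_bits j)"
    using p_near_powr[OF assms] by simp
  show "1 \<le> p_near j powr (- real (concat_len j))"
    unfolding powr_eq using near_bits_pos[OF assms] by (intro ge_one_powr_ge_zero) auto
  have "2 powr (real (concat_len j) * near_bits j)
      \<le> 2 powr (near_bits j + real_of_int (cost_exponent n \<alpha> f \<mu> j))"
    using concat_len_le_cost_exponent[OF assms] by simp
  also have "\<dots> = 2 powr near_bits j * level_cost n \<alpha> f \<mu> j"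
    by (simp add: powr_add level_cost_def)
  also have "\<dots> \<le> table_cost"
    using two_powr_near_bits_le[OF assms] level_cost_le_kernel_cost[OF assms]
    unfolding table_cost_def by (intro mult_mono) (auto simp: level_cost_def)
  finally show "p_near j powr (- real (concat_len j)) \<le> table_cost"
    unfolding powr_eq .
qed

lemma table_cost_ge_1: "1 \<le> table_cost"
proof -
  have "1 \<in> {1..J}" using num_levels_pos[OF mu_pos density_range(2)] by simp
  then show ?thesis
    using p_near_powr_concat_len_ge[of 1] p_near_powr_concat_len_le[of 1] by linarith
qed

lemma num_tables_le:
  assumes "j \<in> {1..J}"
  shows "real (num_tables j) \<le> 101 * log 2 (real n) * table_cost"
proof -
  let ?L = "log 2 (real n)" and ?p = "p_near j powr (- real (concat_len j))"
  have "1 * 1 \<le> ?L * ?p"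
    using log_n_ge_1 p_near_powr_concat_len_ge[OF assms] by (intro mult_mono) auto
  then have "real (num_tables j) \<le> 101 * ?L * ?p" unfolding num_tables_def by linarith
  also have "\<dots> \<le> 101 * ?L * table_cost"
    using p_near_powr_concat_len_le[OF assms] log_n_ge_1 by (intro mult_left_mono) auto
  finally show ?thesis .
qed

lemma concat_len_le:
  assumes "\<alpha> \<le> 1 / 2" "j \<in> {1..J}"
  shows "real (concat_len j) \<le> 2 * real J / b + 1"
proof -
  have "real_of_int (cost_exponent n \<alpha> f \<mu> j) \<le> 2 * real J"
    using cost_exponent_le[OF assms] by linarith
  then have "real (concat_len j) * near_bits j \<le> 2 * real J + near_bits j"
    using concat_len_le_cost_exponent[OF assms(2)] by linarith
  then have "real (concat_len j) \<le> 2 * real J / near_bits j + 1"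
    using near_bits_pos[OF assms(2)] by (simp add: field_simps)
  also have "2 * real J / near_bits j \<le> 2 * real J / b"
    using near_bits_ge[OF assms(2)] b_pos by (intro divide_left_mono) auto
  finally show ?thesis by simp
qed

lemma num_reps_le:
  assumes "0 < C"
  shows "real num_reps \<le> (C + 1) * log 2 (real n) * (1 / \<epsilon>\<^sup>2) * real n powr (A * \<bar>\<beta>\<bar>)"
proof -
  have "\<mu> powr (- \<beta>) \<le> \<mu> powr (- \<bar>\<beta>\<bar>)"
    using mu_pos density_range(2) by (intro powr_mono') auto
  also have "\<dots> \<le> (real n powr (- A)) powr (- \<bar>\<beta>\<bar>)"
    using density_range(1) two_le_n by (intro powr_mono2') auto
  also have "\<dots> = real n powr (A * \<bar>\<beta>\<bar>)" by (simp add: powr_powr)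
  finally have "C * log 2 (real n) / \<epsilon>\<^sup>2 * \<mu> powr (- \<beta>)
      \<le> C * log 2 (real n) / \<epsilon>\<^sup>2 * real n powr (A * \<bar>\<beta>\<bar>)"
    using log_n_ge_1 assms by (intro mult_left_mono) auto
  moreover have "1 * 1 * 1 \<le> log 2 (real n) * (1 / \<epsilon>\<^sup>2) * real n powr (A * \<bar>\<beta>\<bar>)"
    using log_n_ge_1 precision A_pos two_le_n
    by (intro mult_mono ge_one_powr_ge_zero) (auto simp: power_le_one)
  moreover have "0 \<le> C * log 2 (real n) / \<epsilon>\<^sup>2 * \<mu> powr (- \<beta>)" using log_n_ge_1 assms by simp
  then have "real num_reps \<le> C * log 2 (real n) / \<epsilon>\<^sup>2 * \<mu> powr (- \<beta>) + 1"
    unfolding num_reps_def by linarith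
  ultimately show ?thesis by (simp add: algebra_simps add_divide_distrib)
qed

lemma
  assumes "\<alpha> \<le> 1 / 2" "j \<in> {1..J}"
  shows expected_table_time_nonneg: "0 \<le> real (concat_len j) * \<tau> j + 5 * \<sigma>"
    and expected_table_time_le: "real (concat_len j) * \<tau> j + 5 * \<sigma>
      \<le> (2 * (A + 1) / b + 6) * log 2 (real n) * real n powr \<eta>"
proof -
  interpret andoni_indyk_lsh "H j" n d \<alpha> \<eta> B b "radius f j" "p_near j" "\<tau> j"
    by (rule lsh[OF assms(2)])
  let ?L = "log 2 (real n)" and ?N = "real n powr \<eta>"
  show "0 \<le> real (concat_len j) * \<tau> j + 5 * \<sigma>" using eval_time(1) point_time(1) by simp
  have "2 * real J / b \<le> 2 * ((A + 1) * ?L) / b"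
    using num_levels_le[OF two_le_n density_range] b_pos by (intro divide_right_mono) auto
  then have coeff: "2 * real J / b + 6 \<le> (2 * (A + 1) / b + 6) * ?L"
    using log_n_ge_1 by (simp add: algebra_simps add_divide_distrib)
  have "real (concat_len j) * \<tau> j + 5 * \<sigma> \<le> (2 * real J / b + 1) * ?N + 5 * ?N"
    using concat_len_le[OF assms] eval_time point_time b_pos
    by (intro add_mono mult_mono) auto
  also have "\<dots> = (2 * real J / b + 6) * ?N" by (simp add: algebra_simps)
  also have "\<dots> \<le> (2 * (A + 1) / b + 6) * ?L * ?N"
    using coeff by (rule mult_right_mono) simp
  finally show "real (concat_len j) * \<tau> j + 5 * \<sigma> \<le> (2 * (A + 1) / b + 6) * ?L * ?N" .
qed

lemma expected_level_time_le:
  assumes "\<alpha> \<le> 1 / 2" "j \<in> {1..J}"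
  shows "real (num_tables j) * (real (concat_len j) * \<tau> j + 5 * \<sigma>)
    \<le> 101 * (2 * (A + 1) / b + 6) * (log 2 (real n))\<^sup>2 * (table_cost * real n powr \<eta>)"
proof -
  have "real (num_tables j) * (real (concat_len j) * \<tau> j + 5 * \<sigma>)
      \<le> (101 * log 2 (real n) * table_cost)
        * ((2 * (A + 1) / b + 6) * log 2 (real n) * real n powr \<eta>)"
    using num_tables_le[OF assms(2)] expected_table_time_le[OF assms]
      expected_table_time_nonneg[OF assms] log_n_ge_1 table_cost_ge_1
    by (intro mult_mono) auto
  then show ?thesis by (simp only: power2_eq_square mult_ac)
qed

end

definition rep_time_const :: "real \<Rightarrow> real \<Rightarrow> real" where
  "rep_time_const A b = 101 * (A + 1) * (2 * (A + 1) / b + 6) + 2"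

context nondegenerate_kde_instance
begin

lemma expectation_rep_time_le:
  assumes "\<alpha> \<le> 1 / 2"
  shows "(\<integral>R. rep_time R \<partial>rep_space)
    \<le> rep_time_const A b * log 2 (real n) ^ 3 * (table_cost * real n powr \<eta>)"
proof -
  let ?L = "log 2 (real n)" and ?N = "real n powr \<eta>"
  define G where "G = 2 * (A + 1) / b + 6"
  have G_nonneg: "0 \<le> G" using A_pos b_pos by (simp add: G_def)
  have "1 * 1 \<le> ?L ^ 3 * table_cost"
    using log_n_ge_1 table_cost_ge_1 by (intro mult_mono one_le_power) auto
  then have N_le: "?N \<le> ?L ^ 3 * (table_cost * ?N)"
    using mult_right_mono[of 1 "?L ^ 3 * table_cost" ?N] by (simp add: mult.assoc)
  have "(\<integral>R. rep_time R \<partial>rep_space)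
      \<le> (\<Sum>j\<in>{1..J}. real (num_tables j) * (real (concat_len j) * \<tau> j + 5 * \<sigma>)) + 2 * \<sigma>"
    by (rule expectation_rep_time_le_tables)
  also have "\<dots> \<le> (\<Sum>j\<in>{1..J}. 101 * G * ?L\<^sup>2 * (table_cost * ?N)) + 2 * ?N"
    unfolding G_def using point_time(2)
    by (intro add_mono sum_mono expected_level_time_le assms) auto
  also have "\<dots> = real J * (101 * G * ?L\<^sup>2 * (table_cost * ?N)) + 2 * ?N" by simp
  also have "\<dots> \<le> (A + 1) * ?L * (101 * G * ?L\<^sup>2 * (table_cost * ?N))
      + 2 * (?L ^ 3 * (table_cost * ?N))"
    using num_levels_le[OF two_le_n density_range] N_le G_nonneg table_cost_ge_1
    by (intro add_mono mult_right_mono mult_nonneg_nonneg) auto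
  also have "\<dots> = (101 * (A + 1) * G + 2) * ?L ^ 3 * (table_cost * ?N)"
    by (simp add: power2_eq_square power3_eq_cube algebra_simps)
  finally show ?thesis by (simp add: rep_time_const_def G_def)
qed

lemma expectation_query_time_le:
  assumes "0 < C" "\<alpha> \<le> 1 / 2"
  shows "(\<integral>\<omega>. query_time \<omega> \<partial>preprocessing_space)
    \<le> (C + 1) * rep_time_const A b * log 2 (real n) ^ 4
      * (1 / \<epsilon>\<^sup>2 * real n powr (A * \<bar>\<beta>\<bar> + near_loss_exponent B n + \<eta>) * kernel_cost n \<alpha> f \<mu>)"
proof -
  let ?L = "log 2 (real n)"
  let ?T = "rep_time_const A b * ?L ^ 3 * (table_cost * real n powr \<eta>)"
  have "0 \<le> ?T"
    using A_pos b_pos log_n_ge_1 table_cost_ge_1 by (simp add: rep_time_const_def)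
  moreover have "(\<integral>\<omega>. query_time \<omega> \<partial>preprocessing_space) \<le> real num_reps * ?T"
    unfolding expectation_query_time using expectation_rep_time_le[OF assms(2)]
    by (intro mult_left_mono) auto
  moreover have "real num_reps \<le> (C + 1) * ?L * (1 / \<epsilon>\<^sup>2) * real n powr (A * \<bar>\<beta>\<bar>)"
    by (rule num_reps_le[OF assms(1)])
  ultimately have "(\<integral>\<omega>. query_time \<omega> \<partial>preprocessing_space)
      \<le> ((C + 1) * ?L * (1 / \<epsilon>\<^sup>2) * real n powr (A * \<bar>\<beta>\<bar>)) * ?T"
    by (meson mult_right_mono order_trans)
  then show ?thesis
    by (simp add: table_cost_def powr_add power4_eq_xxxx power3_eq_cube mult_ac)
qed

end

theorem theorem4p9:
  fixes A B b C :: real and \<alpha> \<beta> \<eta> :: "nat \<Rightarrow> real"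
  assumes "0 < b" and "0 < C"
    and "\<alpha> \<longlonglongrightarrow> 0" and "\<beta> \<longlonglongrightarrow> 0" and "\<eta> \<longlonglongrightarrow> 0"
  shows "\<exists>(\<delta> :: nat \<Rightarrow> real) (D :: real) (s :: nat) (n0 :: nat). \<delta> \<longlonglongrightarrow> 0 \<and>
    (\<forall>n\<ge>n0. \<forall>d P q f \<mu> \<epsilon> (H :: nat \<Rightarrow> ((nat \<Rightarrow> real) \<Rightarrow> 'b) measure) p_near \<tau> \<sigma>.
       kde_instance A B b (\<alpha> n) (\<eta> n) n d P q f \<mu> \<epsilon> H p_near \<tau> \<sigma> \<longrightarrow>
       integrable (kde_instance.preprocessing_space C (\<alpha> n) (\<beta> n) n P f \<mu> \<epsilon> H p_near)
         (kde_instance.query_time C (\<alpha> n) (\<beta> n) n d P q f \<mu> \<epsilon> p_near \<tau> \<sigma>) \<and>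
       prob_space.expectation (kde_instance.preprocessing_space C (\<alpha> n) (\<beta> n) n P f \<mu> \<epsilon> H p_near)
         (kde_instance.query_time C (\<alpha> n) (\<beta> n) n d P q f \<mu> \<epsilon> p_near \<tau> \<sigma>)
       \<le> D * log 2 (real n) ^ s * (1 / \<epsilon>\<^sup>2 * real n powr \<delta> n * kernel_cost n (\<alpha> n) f \<mu>))"
proof -
  define \<delta> where "\<delta> n = A * \<bar>\<beta> n\<bar> + near_loss_exponent B n + \<eta> n" for n
  have "(\<lambda>n. A * \<bar>\<beta> n\<bar> + near_loss_exponent B n + \<eta> n) \<longlonglongrightarrow> A * \<bar>0\<bar> + 0 + 0"
    by (intro tendsto_intros near_loss_exponent_tendsto_0 assms)
  then have \<delta>: "\<delta> \<longlonglongrightarrow> 0" by (simp add: \<delta>_def[abs_def])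
  have "\<forall>\<^sub>F n in sequentially. \<alpha> n < 1 / 2 \<and> 2 \<le> n"
    using order_tendstoD(2)[OF assms(3), of "1 / 2"] eventually_ge_at_top
    by (intro eventually_conj) auto
  then obtain n0 where n0: "\<And>n. n0 \<le> n \<Longrightarrow> \<alpha> n < 1 / 2 \<and> 2 \<le> n"
    by (auto simp: eventually_sequentially)
  show ?thesis
  proof (intro exI conjI allI impI)
    fix n d P q f \<mu> \<epsilon> p_near \<tau> \<sigma> and H :: "nat \<Rightarrow> ((nat \<Rightarrow> real) \<Rightarrow> 'b) measure"
    assume n: "n0 \<le> n" and inst: "kde_instance A B b (\<alpha> n) (\<eta> n) n d P q f \<mu> \<epsilon> H p_near \<tau> \<sigma>"
    interpret nondegenerate_kde_instance A B b C "\<alpha> n" "\<beta> n" "\<eta> n" n d P q f \<mu> \<epsilon> H p_near \<tau> \<sigma>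
      using inst assms(1) n0[OF n]
      by (intro nondegenerate_kde_instance.intro nondegenerate_kde_instance_axioms.intro) auto
    show "integrable preprocessing_space query_time" by (rule integrable_query_time)
    show "(\<integral>\<omega>. query_time \<omega> \<partial>preprocessing_space) \<le> ((C + 1) * rep_time_const A b)
        * log 2 (real n) ^ 4 * (1 / \<epsilon>\<^sup>2 * real n powr \<delta> n * kernel_cost n (\<alpha> n) f \<mu>)"
      unfolding \<delta>_def using assms(2) n0[OF n] by (intro expectation_query_time_le) auto
  qed (rule \<delta>)
qed

end
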